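(* Let $\mathcal{A}=\{1,\dots,A\}$ and $\mathcal{Y}=\{1,\dots,Y\}$ be finite sets and $\overline{\mathcal{Y}}=\mathcal{Y}\cup\{o\}$. Consider all triples $(\Gamma,\succ,\operatorname{Q})$ consisting of a network $\Gamma$ on $\mathcal{A}$, a profile $\succ=(\succ_a)_{a\in\mathcal{A}}$ of strict preference orders on $\mathcal{Y}$, and an attention mechanism $\operatorname{Q}=(\operatorname{Q}_a)_{a\in\mathcal{A}}$, that satisfy: (A1) $0<\operatorname{Q}_a(v\mid\mathbf{y})<1$ for all $a\in\mathcal{A}$, $v\in\mathcal{Y}$, $\mathbf{y}\in\overline{\mathcal{Y}}^A$; (A2) $|\mathcal{N}_a|>0$ for all $a\in\mathcal{A}$; (A3) for all $a\in\mathcal{A}$, $v\in\mathcal{Y}$, $\mathbf{y}\in\overline{\mathcal{Y}}^A$, $\operatorname{Q}_a(v\mid\mathbf{y})\equiv\operatorname{Q}_a(v\mid y_a,\operatorname{N}_a^v(\mathbf{y}))$ depends on $\mathbf{y}$ only through $y_a$ and $\operatorname{N}^v_a(\mathbf{y})$, and is strictly increasing in $\operatorname{N}^v_a(\mathbf{y})$. Then the set of connections $\Gamma$, the profile of strict preferences $\succ$ and the attention mechanism $\operatorname{Q}$ are point identified from the profile of conditional choice probabilities $\operatorname{P}=(\operatorname{P}_a)_{a\in\mathcal{A}}$; that is, if two such triples induce the same $\operatorname{P}$, then the two triples are equal.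
   Context: A network $\Gamma=(\mathcal{A},e)$ is a directed graph without loops on the node set $\mathcal{A}$; $\mathcal{N}_a=\{a'\in\mathcal{A}: a'\neq a,\ \text{there is an edge from } a \text{ to } a'\}$ is the set of friends of Person $a$. $o\notin\mathcal{Y}$ is a default option. For a choice configuration $\mathbf{y}\in\overline{\mathcal{Y}}^A$, $\operatorname{N}_a^v(\mathbf{y})=\sum_{a'\in\mathcal{N}_a}\mathbf{1}(y_{a'}=v)$ is the number of friends of $a$ choosing $v$. The attention mechanism of $a$ is a function $(v,\mathbf{y})\mapsto\operatorname{Q}_a(v\mid\mathbf{y})$, the probability that $a$ considers $v$ at configuration $\mathbf{y}$ (independently across $v\in\mathcal{Y}$). Person $a$ picks the $\succ_a$-best considered option, or $o$ if no option in $\mathcal{Y}$ is considered, so the induced conditional choice probabilities are $$\operatorname{P}_a(v\mid\mathbf{y})=\operatorname{Q}_a(v\mid\mathbf{y})\prod_{v'\in\mathcal{Y},\,v'\succ_a v}\bigl(1-\operatorname{Q}_a(v'\mid\mathbf{y})\bigr)\ (v\in\mathcal{Y}),\qquad \operatorname{P}_a(o\mid\mathbf{y})=\prod_{v\in\mathcal{Y}}\bigl(1-\operatorname{Q}_a(v\mid\mathbf{y})\bigr).$$ *)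

theory Defs
  imports Complex_Main
begin

text \<open>The set of persons is the finite type \<open>'a\<close> and the set of (non-default) options is the
  finite type \<open>'y\<close>; both are nonempty. In \<open>'y option\<close>, \<open>None\<close> is the default option \<open>o\<close>.\<close>

type_synonym ('a, 'y) config = "'a \<Rightarrow> 'y option"

text \<open>\<open>(a, a') \<in> \<Gamma>\<close>: there is an edge from \<open>a\<close> to \<open>a'\<close>.\<close>

type_synonym 'a network = "('a \<times> 'a) set"

text \<open>\<open>(v', v) \<in> pref a\<close>: Person \<open>a\<close> strictly prefers \<open>v'\<close> to \<open>v\<close>.\<close>

type_synonym ('a, 'y) preferences = "'a \<Rightarrow> ('y \<times> 'y) set"

text \<open>\<open>Q a v y\<close> is the probability that Person \<open>a\<close> considers \<open>v\<close> at configuration \<open>y\<close>.\<close>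

type_synonym ('a, 'y) attention = "'a \<Rightarrow> 'y \<Rightarrow> ('a, 'y) config \<Rightarrow> real"

definition friends :: "'a network \<Rightarrow> 'a \<Rightarrow> 'a set" where
  "friends \<Gamma> a = {a'. a' \<noteq> a \<and> (a, a') \<in> \<Gamma>}"

definition num_friends_choosing ::
    "'a network \<Rightarrow> 'a \<Rightarrow> 'y option \<Rightarrow> ('a, 'y) config \<Rightarrow> nat" where
  "num_friends_choosing \<Gamma> a v y = (\<Sum>a'\<in>friends \<Gamma> a. of_bool (y a' = v))"

definition ccp :: "('a, 'y::finite) preferences \<Rightarrow> ('a, 'y) attention \<Rightarrow>
    'a \<Rightarrow> 'y option \<Rightarrow> ('a, 'y) config \<Rightarrow> real" where
  "ccp pref Q a c y =
    (case c of
      Some v \<Rightarrow> Q a v y * (\<Prod>v'\<in>{v'. (v', v) \<in> pref a}. 1 - Q a v' y)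
    | None \<Rightarrow> (\<Prod>v\<in>UNIV. 1 - Q a v y))"

definition A1 :: "('a, 'y) attention \<Rightarrow> bool" where
  "A1 Q \<longleftrightarrow> (\<forall>a v y. 0 < Q a v y \<and> Q a v y < 1)"

definition A2 :: "'a network \<Rightarrow> bool" where
  "A2 \<Gamma> \<longleftrightarrow> (\<forall>a. card (friends \<Gamma> a) > 0)"

text \<open>\<open>q\<close> is the reduced form of \<open>Q a v\<close>. Monotonicity is required exactly for the
  possible numbers of friends choosing \<open>v\<close>. Since \<open>a\<close> is not a friend of itself, every
  combination of an own choice and such a number does occur at some configuration.\<close>

definition A3 :: "'a network \<Rightarrow> ('a, 'y) attention \<Rightarrow> bool" where
  "A3 \<Gamma> Q \<longleftrightarrow> (\<forall>a v. \<exists>q :: 'y option \<Rightarrow> nat \<Rightarrow> real.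
     (\<forall>y. Q a v y = q (y a) (num_friends_choosing \<Gamma> a (Some v) y)) \<and>
     (\<forall>w. strict_mono_on {0..card (friends \<Gamma> a)} (q w)))"

definition admissible ::
    "'a network \<times> ('a, 'y) preferences \<times> ('a, 'y) attention \<Rightarrow> bool" where
  "admissible = (\<lambda>(\<Gamma>, pref, Q).
     irrefl \<Gamma> \<and> (\<forall>a. strict_linear_order_on UNIV (pref a)) \<and> A1 Q \<and> A2 \<Gamma> \<and> A3 \<Gamma> Q)"

end

theory Submission
  imports Defs
begin

text \<open>Start from the configuration where everybody chooses the default and let one person
  \<open>a' \<noteq> a\<close> switch to an option \<open>v\<close>. If \<open>a'\<close> is a friend of \<open>a\<close>, this strictly raises
  \<open>Q a v\<close> and leaves \<open>Q a u\<close> alone for \<open>u \<noteq> v\<close>; otherwise nothing changes. Hence \<open>a'\<close> is a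
  friend iff the choice probability of \<open>v\<close> moves, and, once a friend is known, \<open>v\<close> is
  preferred to \<open>u \<noteq> v\<close> iff the choice probability of \<open>u\<close> moves. With the preferences known,
  \<open>Q\<close> is recovered from the best option downwards by dividing out the positive factors
  \<open>1 - Q\<close> of the better options.\<close>

abbreviation default_config :: "('a, 'y) config" where
  "default_config \<equiv> \<lambda>_. None"

lemma num_friends_choosing_default_upd:
  fixes \<Gamma> :: "('a::finite) network"
  shows "num_friends_choosing \<Gamma> a (Some u) (default_config(a' := Some v)) =
    of_bool (a' \<in> friends \<Gamma> a \<and> u = v)"
proof -
  have "num_friends_choosing \<Gamma> a (Some u) (default_config(a' := Some v)) =
      (\<Sum>b\<in>friends \<Gamma> a. if b = a' then of_bool (u = v) else 0)"
    unfolding num_friends_choosing_def by (rule sum.cong) auto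
  then show ?thesis
    by simp
qed

lemma num_friends_choosing_default:
  "num_friends_choosing \<Gamma> a (Some u) default_config = 0"
  by (simp add: num_friends_choosing_def)

text \<open>Both arguments of the reduced form \<open>q\<close> stay put:
  \<open>a' \<noteq> a\<close> keeps the own choice at \<open>None\<close>, and the last assumption
  keeps the count at 0.\<close>

lemma attention_upd_eq:
  fixes \<Gamma> :: "('a::finite) network"
  assumes "A3 \<Gamma> Q" and "a' \<noteq> a" and "\<not> (a' \<in> friends \<Gamma> a \<and> u = v)"
  shows "Q a u (default_config(a' := Some v)) = Q a u default_config"
proof -
  obtain q where "Q a u y = q (y a) (num_friends_choosing \<Gamma> a (Some u) y)" for y
    using assms(1) unfolding A3_def by blast
  then show ?thesis
    using assms by (auto simp: num_friends_choosing_default_upd num_friends_choosing_default)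
qed

lemma attention_upd_less:
  fixes \<Gamma> :: "('a::finite) network"
  assumes "A3 \<Gamma> Q" and "a' \<in> friends \<Gamma> a"
  shows "Q a v default_config < Q a v (default_config(a' := Some v))"
proof -
  obtain q where q: "Q a v y = q (y a) (num_friends_choosing \<Gamma> a (Some v) y)"
    and mono: "strict_mono_on {0..card (friends \<Gamma> a)} (q w)" for y w
    using assms(1) unfolding A3_def by blast
  \<comment> \<open>The friend \<open>a'\<close> puts the count 1 into the range on which
    \<open>q\<close> is monotone.\<close>
  have "1 \<le> card (friends \<Gamma> a)"
    using assms(2) by (auto simp: Suc_le_eq card_gt_0_iff)
  then have "q None 0 < q None 1"
    using strict_mono_onD[OF mono, of 0 1 None] by simp
  moreover have "a' \<noteq> a"
    using assms(2) by (simp add: friends_def)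
  ultimately show ?thesis
    using assms(2) by (simp add: q num_friends_choosing_default_upd num_friends_choosing_default)
qed

lemma ccp_Some:
  "ccp pref Q a (Some v) y = Q a v y * (\<Prod>v'\<in>{v'. (v', v) \<in> pref a}. 1 - Q a v' y)"
  by (simp add: ccp_def)

lemma prod_one_minus_attention_pos:
  "A1 Q \<Longrightarrow> 0 < (\<Prod>v\<in>S. 1 - Q a v y)"
  by (auto simp: A1_def intro: prod_pos)

text \<open>The product in the choice probability of \<open>v\<close> runs over options better than
  \<open>v\<close>, hence other than \<open>v\<close>. The switch leaves it fixed and it is nonzero,
  so the probability moves exactly when \<open>Q a v\<close> does, whatever the order is.\<close>

lemma friend_iff_ccp_upd_neq:
  fixes \<Gamma> :: "('a::finite) network" and pref :: "('a, 'y::finite) preferences"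
  assumes "irrefl (pref a)" and "A1 Q" and "A3 \<Gamma> Q" and "a' \<noteq> a"
  shows "a' \<in> friends \<Gamma> a \<longleftrightarrow>
    ccp pref Q a (Some v) (default_config(a' := Some v)) \<noteq> ccp pref Q a (Some v) default_config"
proof -
  let ?S = "{v'. (v', v) \<in> pref a}"
  have "(\<Prod>u\<in>?S. 1 - Q a u (default_config(a' := Some v))) =
      (\<Prod>u\<in>?S. 1 - Q a u default_config)"
  proof (intro prod.cong refl)
    fix u assume "u \<in> ?S"
    then have "u \<noteq> v"
      using assms(1) by (auto simp: irrefl_def)
    then show "1 - Q a u (default_config(a' := Some v)) = 1 - Q a u default_config"
      using attention_upd_eq[OF assms(3,4), of u v] by simp
  qed
  moreover have "(\<Prod>u\<in>?S. 1 - Q a u default_config) \<noteq> 0"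
    using prod_one_minus_attention_pos[OF assms(2)] by (metis less_irrefl)
  moreover have "a' \<in> friends \<Gamma> a \<longleftrightarrow>
      Q a v (default_config(a' := Some v)) \<noteq> Q a v default_config"
    using attention_upd_eq[OF assms(3,4)] attention_upd_less[OF assms(3)]
    by (metis less_irrefl)
  ultimately show ?thesis
    by (simp add: ccp_Some)
qed

text \<open>Since \<open>v \<noteq> u\<close>, the only factor that the switch can move is
  \<open>1 - Q a v\<close>, and it occurs in the choice probability of \<open>u\<close> only if
  \<open>v\<close> is preferred to \<open>u\<close>.\<close>

lemma prefers_iff_ccp_upd_neq:
  fixes \<Gamma> :: "('a::finite) network" and pref :: "('a, 'y::finite) preferences"
  assumes "A1 Q" and "A3 \<Gamma> Q" and friend: "a' \<in> friends \<Gamma> a" and "v \<noteq> u"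
  shows "(v, u) \<in> pref a \<longleftrightarrow>
    ccp pref Q a (Some u) (default_config(a' := Some v)) \<noteq> ccp pref Q a (Some u) default_config"
proof -
  let ?S = "{v'. (v', u) \<in> pref a}" and ?y = "default_config(a' := Some v)"
  have "a' \<noteq> a"
    using friend by (simp add: friends_def)
  then have eq: "Q a w ?y = Q a w default_config" if "w \<noteq> v" for w
    using attention_upd_eq[OF assms(2)] that by metis
  have rest: "(\<Prod>w\<in>?S - {v}. 1 - Q a w ?y) = (\<Prod>w\<in>?S - {v}. 1 - Q a w default_config)"
    by (intro prod.cong) (auto simp: eq)
  \<comment> \<open>These factors must not vanish, or they would hide the move of
    \<open>1 - Q a v\<close>.\<close>
  have pos: "(\<Prod>w\<in>?S - {v}. 1 - Q a w default_config) \<noteq> 0"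
    using prod_one_minus_attention_pos[OF assms(1)] by (metis less_irrefl)
  have Q_pos: "Q a u default_config \<noteq> 0"
    using assms(1) by (metis A1_def less_irrefl)
  show ?thesis
  proof (cases "(v, u) \<in> pref a")
    case True
    then have split: "(\<Prod>w\<in>?S. 1 - Q a w y) = (1 - Q a v y) * (\<Prod>w\<in>?S - {v}. 1 - Q a w y)" for y
      by (intro prod.remove) auto
    have "Q a v ?y \<noteq> Q a v default_config"
      using attention_upd_less[OF assms(2) friend, of v] by simp
    then show ?thesis
      using True \<open>v \<noteq> u\<close> pos Q_pos by (simp add: ccp_Some split rest eq)
  next
    case False
    \<comment> \<open>Now \<open>?S - {v}\<close> is \<open>?S\<close>, so \<open>rest\<close>
      covers the whole product.\<close>
    then show ?thesis
      using \<open>v \<noteq> u\<close> rest by (simp add: ccp_Some eq)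
  qed
qed

text \<open>Pairs in \<open>pref a\<close> put the better option first, so well-founded induction
  along it reaches \<open>v\<close> after all better options. Their factors then agree and, being
  positive, cancel.\<close>

lemma attention_eq_if_ccp_eq:
  fixes pref :: "('a, 'y::finite) preferences"
  assumes order: "strict_linear_order_on UNIV (pref a)"
    and "A1 Q\<^sub>1" and ccp_eq: "ccp pref Q\<^sub>1 = ccp pref Q\<^sub>2"
  shows "Q\<^sub>1 a v y = Q\<^sub>2 a v y"
proof -
  \<comment> \<open>By transitivity \<open>pref a\<close> is its own transitive closure, so
    irreflexivity excludes cycles.\<close>
  have "acyclic (pref a)"
    using order unfolding strict_linear_order_on_def acyclic_irrefl by (metis trancl_id)
  then have "wf (pref a)"
    by (intro finite_acyclic_wf) auto
  then show ?thesis
  proof (induction v rule: wf_induct_rule)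
    case (less v)
    let ?S = "{v'. (v', v) \<in> pref a}"
    have "(\<Prod>u\<in>?S. 1 - Q\<^sub>1 a u y) = (\<Prod>u\<in>?S. 1 - Q\<^sub>2 a u y)"
      using less by (intro prod.cong) auto
    moreover have "ccp pref Q\<^sub>1 a (Some v) y = ccp pref Q\<^sub>2 a (Some v) y"
      by (simp add: ccp_eq)
    moreover have "(\<Prod>u\<in>?S. 1 - Q\<^sub>1 a u y) \<noteq> 0"
      using prod_one_minus_attention_pos[OF assms(2)] by (metis less_irrefl)
    ultimately show ?case
      by (auto simp: ccp_Some)
  qed
qed

theorem proposition4p1:
  fixes \<Gamma>\<^sub>1 \<Gamma>\<^sub>2 :: "('a::finite) network"
    and pref\<^sub>1 pref\<^sub>2 :: "('a, 'y::finite) preferences"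
    and Q\<^sub>1 Q\<^sub>2 :: "('a, 'y) attention"
  assumes "admissible (\<Gamma>\<^sub>1, pref\<^sub>1, Q\<^sub>1)"
    and "admissible (\<Gamma>\<^sub>2, pref\<^sub>2, Q\<^sub>2)"
    and "ccp pref\<^sub>1 Q\<^sub>1 = ccp pref\<^sub>2 Q\<^sub>2"
  shows "(\<Gamma>\<^sub>1, pref\<^sub>1, Q\<^sub>1) = (\<Gamma>\<^sub>2, pref\<^sub>2, Q\<^sub>2)"
proof -
  have irrefl: "irrefl \<Gamma>\<^sub>1" "irrefl \<Gamma>\<^sub>2"
    and order: "strict_linear_order_on UNIV (pref\<^sub>1 a)" "strict_linear_order_on UNIV (pref\<^sub>2 a)"
    and A1: "A1 Q\<^sub>1" "A1 Q\<^sub>2" and "A2 \<Gamma>\<^sub>1" and A3: "A3 \<Gamma>\<^sub>1 Q\<^sub>1" "A3 \<Gamma>\<^sub>2 Q\<^sub>2" for a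
    using assms(1,2) by (auto simp: admissible_def)
  have pref_irrefl: "irrefl (pref\<^sub>1 a)" "irrefl (pref\<^sub>2 a)" for a
    using order by (auto simp: strict_linear_order_on_def)
  have friends_iff: "a' \<in> friends \<Gamma>\<^sub>1 a \<longleftrightarrow> a' \<in> friends \<Gamma>\<^sub>2 a" for a a'
  proof (cases "a' = a")
    case True
    then show ?thesis
      by (simp add: friends_def)
  next
    case False
    then show ?thesis
      \<comment> \<open>Any option can serve as the probe; \<open>undefined\<close> is an arbitrary
        one.\<close>
      using friend_iff_ccp_upd_neq[of pref\<^sub>1 a Q\<^sub>1 \<Gamma>\<^sub>1 a' undefined]
        friend_iff_ccp_upd_neq[of pref\<^sub>2 a Q\<^sub>2 \<Gamma>\<^sub>2 a' undefined]
        pref_irrefl A1 A3 assms(3) by simp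
  qed
  \<comment> \<open>\<open>friends\<close> ignores loops, so the diagonal is settled by
    irreflexivity.\<close>
  have "(a, a') \<in> \<Gamma>\<^sub>1 \<longleftrightarrow> (a, a') \<in> \<Gamma>\<^sub>2" for a a'
    using friends_iff[of a' a] irrefl by (cases "a' = a") (auto simp: friends_def irrefl_def)
  then have \<Gamma>_eq: "\<Gamma>\<^sub>1 = \<Gamma>\<^sub>2"
    by auto
  have "(v, u) \<in> pref\<^sub>1 a \<longleftrightarrow> (v, u) \<in> pref\<^sub>2 a" for a v u
  proof (cases "v = u")
    case True
    then show ?thesis
      using pref_irrefl by (simp add: irrefl_def)
  next
    case False
    \<comment> \<open>The same person must be a friend in both networks, so that one switch tests
      both orders.\<close>
    obtain a' where friend: "a' \<in> friends \<Gamma>\<^sub>1 a"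
      using \<open>A2 \<Gamma>\<^sub>1\<close> by (metis A2_def card.empty equals0I less_irrefl)
    then have friend': "a' \<in> friends \<Gamma>\<^sub>2 a"
      by (simp add: friends_iff)
    show ?thesis
      using prefers_iff_ccp_upd_neq[OF A1(1) A3(1) friend False, of pref\<^sub>1]
        prefers_iff_ccp_upd_neq[OF A1(2) A3(2) friend' False, of pref\<^sub>2] assms(3)
      by simp
  qed
  then have pref_eq: "pref\<^sub>1 = pref\<^sub>2"
    by (intro ext) auto
  have "Q\<^sub>1 a v y = Q\<^sub>2 a v y" for a v y
    using attention_eq_if_ccp_eq[of pref\<^sub>1 a Q\<^sub>1 Q\<^sub>2] order(1) A1(1) assms(3) pref_eq by simp
  then show ?thesis
    using \<Gamma>_eq pref_eq by (simp add: fun_eq_iff)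
qed

end
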